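(* Let $(\gamma_t,f_1,f_2):I\to AdS^3\times\Delta_5$ be a pseudo-spherical timelike framed immersion with curvature $(\alpha,\hat\ell,0,\hat n)$, with $\hat n\neq0$, $\alpha^2\ne\hat n^2$ and $f:=(\alpha\hat n'-\hat n\alpha')^2-\hat\ell^2\hat n^2(\hat n^2-\alpha^2)\neq0$ on $I$. Let $H^T:I\times AdS^3\to\mathbb{R}$ and $H^S:I\times S^3_2\to\mathbb{R}$ be given by $H^T(s,\mathbf{v})=\langle\mu(s),\mathbf{v}\rangle$ and $H^S(s,\mathbf{v})=\langle\mu(s),\mathbf{v}\rangle$. Let $s_0\in I$. (i) Suppose $f(s_0)<0$ and $\hat n^2(s_0)>\alpha^2(s_0)$, and let $\mathbf{v}_0\in AdS^3$. (a) $H^T(s_0,\mathbf{v}_0)=0$ if and only if there exist real numbers $a,b,c$ such that $\mathbf{v}_0=a\gamma_t(s_0)+bf_1(s_0)+cf_2(s_0)$ with $-a^2+b^2+c^2=-1$. (b) $H^T(s_0,\mathbf{v}_0)=\frac{\partial H^T}{\partial s}(s_0,\mathbf{v}_0)=0$ if and only if there exist real numbers $a,b$ such that $\mathbf{v}_0=a\gamma_t(s_0)+bf_1(s_0)-\frac{a\alpha(s_0)}{\hat n(s_0)}f_2(s_0)$ with $\hat n^2(s_0)(1+b^2)=a^2(\hat n^2(s_0)-\alpha^2(s_0))$. (c) $H^T(s_0,\mathbf{v}_0)=\frac{\partial H^T}{\partial s}(s_0,\mathbf{v}_0)=\frac{\partial^2H^T}{\partial s^2}(s_0,\mathbf{v}_0)=0$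 if and only if $\mathbf{v}_0=\mathcal{E}_a(\gamma_t)(s_0)$. (ii) Suppose $f(s_0)>0$ and let $\mathbf{v}_0\in S^3_2$. (a) $H^S(s_0,\mathbf{v}_0)=0$ if and only if there exist real numbers $a,b,c$ such that $\mathbf{v}_0=a\gamma_t(s_0)+bf_1(s_0)+cf_2(s_0)$ with $-a^2+b^2+c^2=1$. (b) $H^S(s_0,\mathbf{v}_0)=\frac{\partial H^S}{\partial s}(s_0,\mathbf{v}_0)=0$ if and only if there exist real numbers $a,b$ such that $\mathbf{v}_0=a\gamma_t(s_0)+bf_1(s_0)-\frac{a\alpha(s_0)}{\hat n(s_0)}f_2(s_0)$ with $\hat n^2(s_0)(b^2-1)=a^2(\hat n^2(s_0)-\alpha^2(s_0))$, where $b^2-1$ and $\hat n^2(s_0)-\alpha^2(s_0)$ have the same sign. (c) $H^S(s_0,\mathbf{v}_0)=\frac{\partial H^S}{\partial s}(s_0,\mathbf{v}_0)=\frac{\partial^2H^S}{\partial s^2}(s_0,\mathbf{v}_0)=0$ if and only if $\mathbf{v}_0=\mathcal{E}_p(\gamma_t)(s_0)$.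
   Context: $\mathbb{R}^4_2$ is $\mathbb{R}^4$ with $\langle u,w\rangle=-u_1w_1-u_2w_2+u_3w_3+u_4w_4$; the triple product $u\times v\times w$ is the unique vector with $\langle x,u\times v\times w\rangle=\det(x,u,v,w)$ for all $x$. $AdS^3=\{u:\langle u,u\rangle=-1\}$, $S^3_2=\{u:\langle u,u\rangle=1\}$, $\Delta_5=\{(u,w)\in S^3_2\times S^3_2:\langle u,w\rangle=0\}$. A pseudo-spherical timelike framed immersion $(\gamma_t,f_1,f_2):I\to AdS^3\times\Delta_5$ is a smooth immersion with $\langle\gamma_t,f_i\rangle=\langle\gamma_t',f_i\rangle=0$, $i=1,2$. Here it has curvature $(\alpha,\hat\ell,0,\hat n)$, meaning that with $\mu=\gamma_t\times f_1\times f_2$ (unit timelike), $$\gamma_t'=\alpha\mu,\quad f_1'=\hat\ell f_2,\quad f_2'=-\hat\ell f_1+\hat n\mu,\quad \mu'=-\alpha\gamma_t+\hat nf_2 .$$ The total evolute, defined up to the sign $\pm$ (both signs are allowed), is $$\mathcal{E}(\gamma_t)=\pm\frac{\hat\ell\hat n(\hat n\gamma_t-\alpha f_2)-(\alpha\hat n'-\hat n\alpha')f_1}{\sqrt{|f|}} ;$$ it is denoted $\mathcal{E}_a(\gamma_t)$ (lying in $AdS^3$) where $f<0$ and $\mathcal{E}_p(\gamma_t)$ (lying in $S^3_2$) where $f>0$.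
   Formalization: In (ii)(b) "have the same sign" is read as: b²−1 = 0 or the signs of b²−1 and n̂²−α² coincide; the literal clause fails for v₀ = ±f₁(s₀), where a = 0 and b² = 1 but n̂² ≠ α². *)

theory Defs
  imports "HOL-Analysis.Analysis"
begin

definition pip :: "real^4 \<Rightarrow> real^4 \<Rightarrow> real" where
  "pip u w = - u$1 * w$1 - u$2 * w$2 + u$3 * w$3 + u$4 * w$4"

definition triple_cross :: "real^4 \<Rightarrow> real^4 \<Rightarrow> real^4 \<Rightarrow> real^4" where
  "triple_cross u v w = (THE y. \<forall>x. pip x y = det (vector [x, u, v, w] :: real^4^4))"

lemma vector_4:
  fixes x y z w :: "'a::zero"
  shows "(vector [x, y, z, w] :: 'a^4) $ 1 = x" "(vector [x, y, z, w] :: 'a^4) $ 2 = y"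
    "(vector [x, y, z, w] :: 'a^4) $ 3 = z" "(vector [x, y, z, w] :: 'a^4) $ 4 = w"
  unfolding vector_def by simp_all

lemma triple_cross_unique_exists:
  "\<exists>!y. \<forall>x. pip x y = det (vector [x, u, v, w] :: real^4^4)"
proof -
  define \<phi> where "\<phi> x = det (vector [x, u, v, w] :: real^4^4)" for x
  have vec: "(vector [x, u, v, w] :: real^4^4) =
      (\<chi> i. if i = 1 then x else (vector [0, u, v, w] :: real^4^4) $ i)" for x
    by (simp add: vec_eq_iff forall_4 vector_4)
  have add: "\<phi> (x + y) = \<phi> x + \<phi> y" for x y
    unfolding \<phi>_def vec[of "x + y"] vec[of x] vec[of y]
    by (rule det_row_add)
  have scale: "\<phi> (c *s x) = c * \<phi> x" for c x
    unfolding \<phi>_def vec[of "c *s x"] vec[of x]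
    by (rule det_row_mul)
  define y :: "real^4" where
    "y = vector [- \<phi> (axis 1 1), - \<phi> (axis 2 1), \<phi> (axis 3 1), \<phi> (axis 4 1)]"
  have expand: "x = x$1 *s axis 1 1 + (x$2 *s axis 2 1 + (x$3 *s axis 3 1 + x$4 *s axis 4 1))"
    for x :: "real^4"
    by (simp add: vec_eq_iff forall_4 axis_def)
  have "pip x y = \<phi> x" for x
    by (subst (2) expand[of x]) (simp add: add scale pip_def y_def vector_4)
  moreover have "z = y" if "\<forall>x. pip x z = \<phi> x" for z
  proof -
    have "pip (axis i 1) z = pip (axis i 1) y" for i
      using that \<open>\<And>x. pip x y = \<phi> x\<close> by simp
    from this[of 1] this[of 2] this[of 3] this[of 4] show ?thesis
      by (simp add: pip_def axis_def vec_eq_iff forall_4)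
  qed
  ultimately show ?thesis
    unfolding \<phi>_def by blast
qed

lemma pip_triple_cross:
  "pip x (triple_cross u v w) = det (vector [x, u, v, w] :: real^4^4)"
  using theI'[OF triple_cross_unique_exists[of u v w]]
  unfolding triple_cross_def by blast

definition AdS3 :: "(real^4) set" where
  "AdS3 = {u. pip u u = - 1}"

definition S32 :: "(real^4) set" where
  "S32 = {u. pip u u = 1}"

definition Delta5 :: "((real^4) \<times> (real^4)) set" where
  "Delta5 = {(u, w) \<in> S32 \<times> S32. pip u w = 0}"

text \<open>
  Derivatives are taken within the interval, so that an endpoint belonging to it
  carries one-sided derivatives; on an open interval they are the usual ones.
\<close>

definition deriv_within :: "real set \<Rightarrow> (real \<Rightarrow> 'a::real_normed_vector) \<Rightarrow> real \<Rightarrow> 'a" where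
  "deriv_within I c s = vector_derivative c (at s within I)"

text \<open>The function \<open>D k\<close> is the derivative of order \<open>k\<close>.\<close>

definition smooth_curve_on :: "real set \<Rightarrow> (real \<Rightarrow> 'a::real_normed_vector) \<Rightarrow> bool" where
  "smooth_curve_on I c \<longleftrightarrow>
     (\<exists>D :: nat \<Rightarrow> real \<Rightarrow> 'a.
        (\<forall>s\<in>I. D 0 s = c s) \<and>
        (\<forall>k. \<forall>s\<in>I. (D k has_vector_derivative D (Suc k) s) (at s within I)))"

definition smooth_immersion_on :: "real set \<Rightarrow> (real \<Rightarrow> 'a::real_normed_vector) \<Rightarrow> bool" where
  "smooth_immersion_on I c \<longleftrightarrow> smooth_curve_on I c \<and> (\<forall>s\<in>I. deriv_within I c s \<noteq> 0)"

definition timelike_framed_immersion ::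
    "real set \<Rightarrow> (real \<Rightarrow> real^4) \<Rightarrow> (real \<Rightarrow> real^4) \<Rightarrow> (real \<Rightarrow> real^4) \<Rightarrow> bool" where
  "timelike_framed_immersion I \<gamma> f1 f2 \<longleftrightarrow>
     smooth_immersion_on I (\<lambda>s. (\<gamma> s, f1 s, f2 s)) \<and>
     (\<forall>s\<in>I. \<gamma> s \<in> AdS3 \<and> (f1 s, f2 s) \<in> Delta5 \<and>
        pip (\<gamma> s) (f1 s) = 0 \<and> pip (\<gamma> s) (f2 s) = 0 \<and>
        pip (deriv_within I \<gamma> s) (f1 s) = 0 \<and> pip (deriv_within I \<gamma> s) (f2 s) = 0)"

definition frame_mu ::
    "(real \<Rightarrow> real^4) \<Rightarrow> (real \<Rightarrow> real^4) \<Rightarrow> (real \<Rightarrow> real^4) \<Rightarrow> real \<Rightarrow> real^4" where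
  "frame_mu \<gamma> f1 f2 s = triple_cross (\<gamma> s) (f1 s) (f2 s)"

text \<open>The curvature is the quadruple \<open>(\<alpha>, l, 0, n)\<close>; its vanishing third entry is not an argument.\<close>

definition has_curvature ::
    "real set \<Rightarrow> (real \<Rightarrow> real^4) \<Rightarrow> (real \<Rightarrow> real^4) \<Rightarrow> (real \<Rightarrow> real^4) \<Rightarrow>
     (real \<Rightarrow> real) \<Rightarrow> (real \<Rightarrow> real) \<Rightarrow> (real \<Rightarrow> real) \<Rightarrow> bool" where
  "has_curvature I \<gamma> f1 f2 \<alpha> l n \<longleftrightarrow>
     (let \<mu> = frame_mu \<gamma> f1 f2 in
      \<forall>s\<in>I.
        (\<gamma> has_vector_derivative \<alpha> s *\<^sub>R \<mu> s) (at s within I) \<and>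
        (f1 has_vector_derivative l s *\<^sub>R f2 s) (at s within I) \<and>
        (f2 has_vector_derivative - l s *\<^sub>R f1 s + n s *\<^sub>R \<mu> s) (at s within I) \<and>
        (\<mu> has_vector_derivative - \<alpha> s *\<^sub>R \<gamma> s + n s *\<^sub>R f2 s) (at s within I))"

definition evolute_discr ::
    "real set \<Rightarrow> (real \<Rightarrow> real) \<Rightarrow> (real \<Rightarrow> real) \<Rightarrow> (real \<Rightarrow> real) \<Rightarrow> real \<Rightarrow> real" where
  "evolute_discr I \<alpha> l n s =
     (\<alpha> s * deriv_within I n s - n s * deriv_within I \<alpha> s)\<^sup>2
     - (l s)\<^sup>2 * (n s)\<^sup>2 * ((n s)\<^sup>2 - (\<alpha> s)\<^sup>2)"

text \<open>
  The total evolute is defined only up to sign: its two values at \<open>s\<close> are the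
  elements of this set.
\<close>

definition total_evolute ::
    "real set \<Rightarrow> (real \<Rightarrow> real^4) \<Rightarrow> (real \<Rightarrow> real^4) \<Rightarrow> (real \<Rightarrow> real^4) \<Rightarrow>
     (real \<Rightarrow> real) \<Rightarrow> (real \<Rightarrow> real) \<Rightarrow> (real \<Rightarrow> real) \<Rightarrow> real \<Rightarrow> (real^4) set" where
  "total_evolute I \<gamma> f1 f2 \<alpha> l n s =
     (let e = (1 / sqrt \<bar>evolute_discr I \<alpha> l n s\<bar>) *\<^sub>R
            ((l s * n s) *\<^sub>R (n s *\<^sub>R \<gamma> s - \<alpha> s *\<^sub>R f2 s)
             - (\<alpha> s * deriv_within I n s - n s * deriv_within I \<alpha> s) *\<^sub>R f1 s)
      in {e, - e})"

text \<open>
  The two height functions, on \<open>I \<times> AdS3\<close> and on \<open>I \<times> S32\<close>, are given by the same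
  formula and are both restrictions of this function.
\<close>

definition height_fun ::
    "(real \<Rightarrow> real^4) \<Rightarrow> (real \<Rightarrow> real^4) \<Rightarrow> (real \<Rightarrow> real^4) \<Rightarrow> real \<Rightarrow> real^4 \<Rightarrow> real" where
  "height_fun \<gamma> f1 f2 s v = pip (frame_mu \<gamma> f1 f2 s) v"

definition height_ds ::
    "real set \<Rightarrow> (real \<Rightarrow> real^4) \<Rightarrow> (real \<Rightarrow> real^4) \<Rightarrow> (real \<Rightarrow> real^4) \<Rightarrow> real \<Rightarrow> real^4 \<Rightarrow> real" where
  "height_ds I \<gamma> f1 f2 s v = deriv_within I (\<lambda>t. height_fun \<gamma> f1 f2 t v) s"

definition height_dss ::
    "real set \<Rightarrow> (real \<Rightarrow> real^4) \<Rightarrow> (real \<Rightarrow> real^4) \<Rightarrow> (real \<Rightarrow> real^4) \<Rightarrow> real \<Rightarrow> real^4 \<Rightarrow> real" where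
  "height_dss I \<gamma> f1 f2 s v = deriv_within I (\<lambda>t. height_ds I \<gamma> f1 f2 t v) s"

end

theory Submission
  imports Defs
begin

text \<open>
  The vectors \<open>\<gamma>, f\<^sub>1, f\<^sub>2, \<mu>\<close> form a pseudo-orthonormal basis, so \<open>\<langle>\<mu>, v\<rangle> = 0\<close> means
  \<open>v = a \<gamma> + b f\<^sub>1 + c f\<^sub>2\<close>. The frame equations turn the vanishing of the first derivative of
  the height function into \<open>\<alpha> a + n c = 0\<close>, and that of the second into
  \<open>a (\<alpha> n' - n \<alpha>') = - n\<^sup>2 l b\<close>. Together they say that \<open>v\<close> is a multiple of the vector
  \<open>l n (n \<gamma> - \<alpha> f\<^sub>2) - (\<alpha> n' - n \<alpha>') f\<^sub>1\<close>, whose pseudo-norm squared is the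
  discriminant; normalising leaves the two values of the total evolute.
\<close>

section \<open>The indefinite form as a bilinear map\<close>

lemma bounded_bilinear_pip: "bounded_bilinear pip"
  unfolding bilinear_conv_bounded_bilinear[symmetric] bilinear_def
  by (auto intro!: linearI simp: pip_def algebra_simps)

lemma pip_commute: "pip x y = pip y x"
  by (simp add: pip_def)

lemmas pip_linear_simps =
  bounded_bilinear.add_left[OF bounded_bilinear_pip]
  bounded_bilinear.add_right[OF bounded_bilinear_pip]
  bounded_bilinear.diff_left[OF bounded_bilinear_pip]
  bounded_bilinear.diff_right[OF bounded_bilinear_pip]
  bounded_bilinear.minus_left[OF bounded_bilinear_pip]
  bounded_bilinear.minus_right[OF bounded_bilinear_pip]
  bounded_bilinear.zero_right[OF bounded_bilinear_pip]
  bounded_bilinear.scaleR_left[OF bounded_bilinear_pip]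
  bounded_bilinear.scaleR_right[OF bounded_bilinear_pip]

lemmas has_vector_derivative_pip =
  bounded_bilinear.has_vector_derivative[OF bounded_bilinear_pip]

lemma pip_eqI: "x = y" if "\<And>z. pip z x = pip z y"
  using that[of "axis 1 1"] that[of "axis 2 1"] that[of "axis 3 1"] that[of "axis 4 1"]
  by (simp add: pip_def axis_def vec_eq_iff forall_4)

section \<open>Determinants of Gram matrices\<close>

text \<open>In the Leibniz sum, the zeros off the diagonal outside the first row and column leave
  only the identity and the transpositions of 1 with another index.\<close>

lemma det_arrowhead_4:
  fixes A :: "real^4^4"
  assumes "\<And>i j. i \<noteq> 1 \<Longrightarrow> j \<noteq> 1 \<Longrightarrow> i \<noteq> j \<Longrightarrow> A$i$j = 0"
  shows "det A = A$1$1 * A$2$2 * A$3$3 * A$4$4 - A$1$2 * A$2$1 * A$3$3 * A$4$4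
     - A$1$3 * A$3$1 * A$2$2 * A$4$4 - A$1$4 * A$4$1 * A$2$2 * A$3$3"
proof -
  have z: "A$2$3 = 0" "A$2$4 = 0" "A$3$2 = 0" "A$3$4 = 0" "A$4$2 = 0" "A$4$3 = 0"
    using assms by simp_all
  have f1234: "finite {2::4, 3, 4}" "1 \<notin> {2::4, 3, 4}" by auto
  have f234: "finite {3::4, 4}" "2 \<notin> {3::4, 4}" by auto
  have f34: "finite {4::4}" "3 \<notin> {4::4}" by auto
  show ?thesis
    unfolding det_def UNIV_4
    unfolding sum_over_permutations_insert[OF f1234]
    unfolding sum_over_permutations_insert[OF f234]
    unfolding sum_over_permutations_insert[OF f34]
    unfolding permutes_sing
    by (simp add: z sign_swap_id permutation_swap_id sign_compose permutation_compose swap_id_eq)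
qed

text \<open>The form has matrix diag(-1, -1, 1, 1), called \<open>G\<close>, so the pairings form
  the product \<open>A ** G ** transpose B\<close>; the two minus signs cancel in
  \<open>det G\<close>.\<close>

lemma det_pip_matrix:
  fixes A B :: "real^4^4"
  shows "det (\<chi> i j. pip (A$i) (B$j)) = det A * det B"
proof -
  define G :: "real^4^4" where
    "G = (\<chi> i j. if i = j then (if i = 1 \<or> i = 2 then - 1 else 1) else 0)"
  have "(\<chi> i j. pip (A$i) (B$j)) = A ** G ** transpose B"
    by (simp add: vec_eq_iff matrix_matrix_mult_def transpose_def sum_4 G_def pip_def forall_4)
  moreover have "det G = 1"
  proof -
    have "det G = (\<Prod>i\<in>UNIV. G$i$i)"
      by (rule det_diagonal) (simp add: G_def)
    then show ?thesis
      unfolding UNIV_4 by (simp add: G_def)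
  qed
  ultimately show ?thesis
    by (simp add: det_mul)
qed

section \<open>Algebra of a pseudo-orthonormal frame\<close>

locale timelike_frame =
  fixes u v w :: "real^4"
  assumes pip_u: "pip u u = - 1" and pip_v: "pip v v = 1" and pip_w: "pip w w = 1"
    and pip_uv: "pip u v = 0" and pip_uw: "pip u w = 0" and pip_vw: "pip v w = 0"
begin

abbreviation m :: "real^4" where "m \<equiv> triple_cross u v w"

lemma frame_simps:
  "pip u u = - 1" "pip v v = 1" "pip w w = 1" "pip u v = 0" "pip v u = 0" "pip u w = 0"
  "pip w u = 0" "pip v w = 0" "pip w v = 0"
  using pip_u pip_v pip_w pip_uv pip_uw pip_vw by (simp_all add: pip_commute)

lemma frame_m_simps:
  "pip u m = 0" "pip v m = 0" "pip w m = 0" "pip m u = 0" "pip m v = 0" "pip m w = 0"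
proof -
  show um: "pip u m = 0"
    unfolding pip_triple_cross by (rule det_identical_rows[of 1 2]) (simp_all add: row_def vector_4)
  show vm: "pip v m = 0"
    unfolding pip_triple_cross by (rule det_identical_rows[of 1 3]) (simp_all add: row_def vector_4)
  show wm: "pip w m = 0"
    unfolding pip_triple_cross by (rule det_identical_rows[of 1 4]) (simp_all add: row_def vector_4)
  show "pip m u = 0" "pip m v = 0" "pip m w = 0"
    using um vm wm by (simp_all add: pip_commute)
qed

text \<open>Both factors on the left are determinants, so their product is the Gram determinant of
  \<open>x, u, v, w\<close> against \<open>y, u, v, w\<close>; orthonormality of
  \<open>u, v, w\<close> makes that matrix an arrowhead.\<close>

lemma pip_m_mult_pip_m:
  "pip x m * pip y m = - pip x y - pip x u * pip y u + pip x v * pip y v + pip x w * pip y w"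
proof -
  define M :: "real^4^4" where
    "M = (\<chi> i j. pip ((vector [x, u, v, w] :: real^4^4)$i) ((vector [y, u, v, w] :: real^4^4)$j))"
  have "M$i$j = 0" if "i \<noteq> 1" "j \<noteq> 1" "i \<noteq> j" for i j
    using exhaust_4[of i] exhaust_4[of j] that by (auto simp: M_def vector_4 frame_simps)
  from det_arrowhead_4[OF this] have "det M = - pip x y - pip x u * pip y u + pip x v * pip y v + pip x w * pip y w"
    by (simp add: M_def vector_4 frame_simps pip_commute[of u y] pip_commute[of v y] pip_commute[of w y])
  moreover have "det M = pip x m * pip y m"
    unfolding M_def pip_triple_cross by (rule det_pip_matrix)
  ultimately show ?thesis
    by simp
qed

text \<open>The product identity is this expansion paired with an arbitrary \<open>z\<close>, and
  nondegeneracy removes \<open>z\<close>. The value of \<open>pip m m\<close> is not presupposed; it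
  is deduced from the expansion.\<close>

lemma frame_expansion:
  "x = - pip x u *\<^sub>R u + pip x v *\<^sub>R v + pip x w *\<^sub>R w - pip x m *\<^sub>R m"
proof (rule pip_eqI)
  fix z
  show "pip z x = pip z (- pip x u *\<^sub>R u + pip x v *\<^sub>R v + pip x w *\<^sub>R w - pip x m *\<^sub>R m)"
    using pip_m_mult_pip_m[of z x] by (simp add: pip_linear_simps algebra_simps)
qed

text \<open>Taking the trace of the expansion of the identity gives \<open>4 = 1 + 1 + 1 - \<langle>m, m\<rangle>\<close>.\<close>

lemma pip_m_m: "pip m m = - 1"
proof -
  have comp: "(axis i 1 :: real^4)$i = - pip (axis i 1) u * u$i + pip (axis i 1) v * v$i
      + pip (axis i 1) w * w$i - pip (axis i 1) m * m$i" for i :: 4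
    using arg_cong[OF frame_expansion[of "axis i 1"], of "\<lambda>y. y$i"] by simp
  have "4 = - pip u u + pip v v + pip w w - pip m m"
    using comp[of 1] comp[of 2] comp[of 3] comp[of 4] by (simp add: pip_def axis_def)
  then show ?thesis
    by (simp add: frame_simps)
qed

lemma pip_combination:
  assumes "x = a *\<^sub>R u + b *\<^sub>R v + c *\<^sub>R w"
  shows "pip u x = - a" "pip v x = b" "pip w x = c" "pip m x = 0"
    "pip x x = - a\<^sup>2 + b\<^sup>2 + c\<^sup>2"
  unfolding assms
  by (simp_all add: pip_linear_simps frame_simps frame_m_simps power2_eq_square)

lemma pip_m_zeroE:
  assumes "pip m x = 0"
  obtains a b c where "x = a *\<^sub>R u + b *\<^sub>R v + c *\<^sub>R w"
  using frame_expansion[of x] assms by (metis diff_zero pip_commute scale_zero_left)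

section \<open>Contact conditions of order one, two and three\<close>

text \<open>Here and below \<open>e\<close> is -1 for \<open>AdS3\<close> and 1 for
  \<open>S32\<close>, so that each contact order is treated once for both.\<close>

lemma contact_order_1:
  assumes "pip x x = e"
  shows "pip m x = 0 \<longleftrightarrow>
    (\<exists>a b c. x = a *\<^sub>R u + b *\<^sub>R v + c *\<^sub>R w \<and> - a\<^sup>2 + b\<^sup>2 + c\<^sup>2 = e)"
  using assms pip_combination by (metis pip_m_zeroE)

text \<open>The second equation says \<open>\<alpha> * a + n * c = 0\<close>, which determines
  \<open>c\<close>; the quadratic relation is then the norm condition multiplied by
  \<open>n\<^sup>2\<close>.\<close>

lemma contact_order_2:
  assumes x: "pip x x = e" and n: "n \<noteq> (0::real)"
  shows "pip m x = 0 \<and> - \<alpha> * pip u x + n * pip w x = 0 \<longleftrightarrow>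
    (\<exists>a b. x = a *\<^sub>R u + b *\<^sub>R v - (a * \<alpha> / n) *\<^sub>R w \<and>
       n\<^sup>2 * (b\<^sup>2 - e) = a\<^sup>2 * (n\<^sup>2 - \<alpha>\<^sup>2))" (is "?L \<longleftrightarrow> ?R")
proof
  assume L: ?L
  then obtain a b c where abc: "x = a *\<^sub>R u + b *\<^sub>R v + c *\<^sub>R w"
    using pip_m_zeroE by blast
  note p = pip_combination[OF abc]
  have "\<alpha> * a + n * c = 0"
    using L p by simp
  then have c: "c = - (a * \<alpha> / n)"
    using n by (simp add: field_simps)
  have "e = - a\<^sup>2 + b\<^sup>2 + (a * \<alpha> / n)\<^sup>2"
    using p(5) x c by simp
  then have "n\<^sup>2 * (b\<^sup>2 - e) = a\<^sup>2 * (n\<^sup>2 - \<alpha>\<^sup>2)"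
    using n by (simp add: power_divide power_mult_distrib field_simps)
  with abc c show ?R by auto
next
  assume ?R
  then obtain a b where "x = a *\<^sub>R u + b *\<^sub>R v + (- (a * \<alpha> / n)) *\<^sub>R w"
    by auto
  from pip_combination[OF this] n show ?L by simp
qed

text \<open>Pure algebra at one point: \<open>\<alpha>'\<close> and \<open>n'\<close> are arbitrary
  reals standing for the derivatives. The condition on \<open>e\<close> ties the quadric containing
  \<open>x\<close> to the sign of \<open>F\<close>.\<close>

lemma contact_order_3:
  fixes \<alpha> l n \<alpha>' n' e :: real
  defines "W \<equiv> \<alpha> * n' - n * \<alpha>'"
  defines "F \<equiv> W\<^sup>2 - l\<^sup>2 * n\<^sup>2 * (n\<^sup>2 - \<alpha>\<^sup>2)"
  defines "E \<equiv> (1 / sqrt \<bar>F\<bar>) *\<^sub>R ((l * n) *\<^sub>R (n *\<^sub>R u - \<alpha> *\<^sub>R w) - W *\<^sub>R v)"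
  assumes x: "pip x x = e" and n: "n \<noteq> 0" and F: "F \<noteq> 0" and e: "e = sgn F"
  shows "pip m x = 0 \<and> - \<alpha> * pip u x + n * pip w x = 0 \<and>
      - \<alpha>' * pip u x - \<alpha>\<^sup>2 * pip m x + n' * pip w x + n * (- l * pip v x + n * pip m x) = 0
    \<longleftrightarrow> x \<in> {E, - E}" (is "?L \<longleftrightarrow> ?R")
proof
  assume L: ?L
  then obtain a b c where abc: "x = a *\<^sub>R u + b *\<^sub>R v + c *\<^sub>R w"
    using pip_m_zeroE by blast
  note p = pip_combination[OF abc]
  have h1: "\<alpha> * a + n * c = 0" and h2: "\<alpha>' * a + n' * c - n * l * b = 0"
    using L p by simp_all
  \<comment> \<open>Eliminate \<open>c\<close>: subtract \<open>n\<close> times \<open>h2\<close>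
    from \<open>n'\<close> times \<open>h1\<close>.\<close>
  have key: "a * W = - (n\<^sup>2 * l * b)"
    using h1 h2 unfolding W_def by algebra
  have nl: "l \<noteq> 0 \<or> W \<noteq> 0"
    using F unfolding F_def by auto
  \<comment> \<open>\<open>t\<close> is the factor of \<open>x\<close> along the unnormalised
    evolute vector. It is read off from the \<open>u\<close> coefficient if \<open>l\<close> is
    nonzero; otherwise \<open>W\<close> is nonzero, \<open>a\<close> and \<open>c\<close> vanish,
    and the \<open>v\<close> coefficient gives it.\<close>
  obtain t where t: "a = t * (l * n\<^sup>2)" "b = - t * W" "c = - t * (l * n * \<alpha>)"
  proof (cases "l = 0")
    case True
    then show ?thesis
      using that[of "- b / W"] key nl h1 n by simp
  next
    case False
    define t where "t = a / (l * n\<^sup>2)"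
    have a: "a = t * (l * n\<^sup>2)"
      unfolding t_def using False n by simp
    have "n\<^sup>2 * l * (b + t * W) = 0"
      using key unfolding a by (simp add: algebra_simps)
    moreover have "n * (c + t * (l * n * \<alpha>)) = 0"
      using h1 unfolding a by (simp add: algebra_simps power2_eq_square)
    ultimately show ?thesis
      using that[of t] a n False by (simp add: eq_neg_iff_add_eq_0)
  qed
  \<comment> \<open>The unnormalised vector has pseudo-norm squared \<open>F\<close>, so the norm of
    \<open>x\<close> fixes \<open>t\<close> up to sign.\<close>
  have "sgn F = t\<^sup>2 * F"
    using x e p(5) unfolding t F_def by (simp add: algebra_simps power2_eq_square)
  then have "t\<^sup>2 = (1 / sqrt \<bar>F\<bar>)\<^sup>2"
    using F by (simp add: power_divide field_simps sgn_if split: if_splits)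
  then have "t = 1 / sqrt \<bar>F\<bar> \<or> t = - (1 / sqrt \<bar>F\<bar>)"
    by (rule power2_eq_iff[THEN iffD1])
  moreover have "x = t *\<^sub>R ((l * n) *\<^sub>R (n *\<^sub>R u - \<alpha> *\<^sub>R w) - W *\<^sub>R v)"
    unfolding abc t by (simp add: algebra_simps power2_eq_square)
  ultimately show ?R
    unfolding E_def by auto
next
  assume ?R
  \<comment> \<open>The three equations are linear in \<open>x\<close>, so one scalar
    \<open>t\<close> covers both signs.\<close>
  then obtain t where "x = t *\<^sub>R ((l * n) *\<^sub>R (n *\<^sub>R u - \<alpha> *\<^sub>R w) - W *\<^sub>R v)"
    unfolding E_def by (metis insertE scaleR_minus_left singletonD)
  then have "x = (t * (l * n\<^sup>2)) *\<^sub>R u + (- t * W) *\<^sub>R v + (- t * (l * n * \<alpha>)) *\<^sub>R w"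
    by (simp add: algebra_simps power2_eq_square)
  note p = pip_combination(1-4)[OF this]
  show ?L
    unfolding p W_def by (simp add: algebra_simps power2_eq_square)
qed

end

section \<open>Derivatives of the curvature and of the height function\<close>

text \<open>Nonempty interior excludes singletons, so every point of the interval, endpoints
  included, is a limit point and the derivative within \<open>I\<close> is unique.\<close>

lemma deriv_within_eqI:
  fixes I :: "real set"
  assumes "is_interval I" "interior I \<noteq> {}" "s \<in> I"
    and f: "(f has_vector_derivative d) (at s within I)"
  shows "deriv_within I f s = d"
proof -
  have "I \<noteq> {x}" for x
    using assms(2) by auto
  then have "s islimpt I"
    using assms by (intro connected_imp_perfect) (auto simp: is_interval_connected)
  then have "at s within I \<noteq> bot"
    by (simp add: trivial_limit_within)
  then show ?thesis
    unfolding deriv_within_def using f by (rule vector_derivative_within)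
qed

lemma framed_timelike_frame:
  assumes "timelike_framed_immersion I \<gamma> f1 f2" "s \<in> I"
  shows "timelike_frame (\<gamma> s) (f1 s) (f2 s)"
  using assms by unfold_locales
    (auto simp: timelike_framed_immersion_def AdS3_def S32_def Delta5_def)

text \<open>The curvature functions are recovered from the frame as \<open>\<alpha> = - \<langle>\<gamma>', \<mu>\<rangle>\<close> and
  \<open>n = - \<langle>f\<^sub>2', \<mu>\<rangle>\<close>, so they inherit differentiability from it.\<close>

lemma curvature_differentiable:
  fixes I :: "real set"
  assumes I: "is_interval I" "interior I \<noteq> {}"
    and framed: "timelike_framed_immersion I \<gamma> f1 f2"
    and curvature: "has_curvature I \<gamma> f1 f2 \<alpha> l n"
    and s: "s \<in> I"
  shows "(\<alpha> has_vector_derivative deriv_within I \<alpha> s) (at s within I)"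
    and "(n has_vector_derivative deriv_within I n s) (at s within I)"
proof -
  let ?\<mu> = "frame_mu \<gamma> f1 f2"
  obtain D :: "nat \<Rightarrow> real \<Rightarrow> (real^4) \<times> (real^4) \<times> (real^4)"
    where D0: "\<And>t. t \<in> I \<Longrightarrow> D 0 t = (\<gamma> t, f1 t, f2 t)"
      and D: "\<And>k t. t \<in> I \<Longrightarrow> (D k has_vector_derivative D (Suc k) t) (at t within I)"
    using framed unfolding timelike_framed_immersion_def smooth_immersion_on_def smooth_curve_on_def
    by blast
  have d\<gamma>: "(\<gamma> has_vector_derivative \<alpha> t *\<^sub>R ?\<mu> t) (at t within I)"
    and df2: "(f2 has_vector_derivative - l t *\<^sub>R f1 t + n t *\<^sub>R ?\<mu> t) (at t within I)"
    and d\<mu>: "(?\<mu> has_vector_derivative - \<alpha> t *\<^sub>R \<gamma> t + n t *\<^sub>R f2 t) (at t within I)"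
    if "t \<in> I" for t
    using curvature that unfolding has_curvature_def Let_def by blast+
  have fst_D: "((\<lambda>t. fst (D k t)) has_vector_derivative fst (D (Suc k) t)) (at t within I)"
    and snd_D: "((\<lambda>t. snd (snd (D k t))) has_vector_derivative snd (snd (D (Suc k) t))) (at t within I)"
    if "t \<in> I" for k t
    using D[OF that, of k]
    by (auto intro!: bounded_linear.has_vector_derivative[OF bounded_linear_fst]
        bounded_linear.has_vector_derivative[OF bounded_linear_snd])
  have 1: "fst (D (Suc 0) t) = \<alpha> t *\<^sub>R ?\<mu> t"
    and 2: "snd (snd (D (Suc 0) t)) = - l t *\<^sub>R f1 t + n t *\<^sub>R ?\<mu> t" if t: "t \<in> I" for t
  proof -
    \<comment> \<open>\<open>D 0\<close> is known to agree with the curve only on \<open>I\<close>;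
      uniqueness of the derivative within \<open>I\<close> then identifies \<open>D (Suc 0)\<close>
      with the frame equations.\<close>
    have "((\<lambda>t. fst (D 0 t)) has_vector_derivative \<alpha> t *\<^sub>R ?\<mu> t) (at t within I)"
      using t D0 by (intro has_vector_derivative_transform[OF t _ d\<gamma>]) auto
    then show "fst (D (Suc 0) t) = \<alpha> t *\<^sub>R ?\<mu> t"
      using deriv_within_eqI[OF I t] fst_D[OF t, of 0] by metis
    have "((\<lambda>t. snd (snd (D 0 t))) has_vector_derivative - l t *\<^sub>R f1 t + n t *\<^sub>R ?\<mu> t) (at t within I)"
      using t D0 by (intro has_vector_derivative_transform[OF t _ df2]) auto
    then show "snd (snd (D (Suc 0) t)) = - l t *\<^sub>R f1 t + n t *\<^sub>R ?\<mu> t"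
      using deriv_within_eqI[OF I t] snd_D[OF t, of 0] by metis
  qed
  have \<alpha>: "\<alpha> t = - pip (fst (D (Suc 0) t)) (?\<mu> t)"
    and n: "n t = - pip (snd (snd (D (Suc 0) t))) (?\<mu> t)" if t: "t \<in> I" for t
  proof -
    interpret timelike_frame "\<gamma> t" "f1 t" "f2 t"
      using framed t by (rule framed_timelike_frame)
    show "\<alpha> t = - pip (fst (D (Suc 0) t)) (?\<mu> t)" "n t = - pip (snd (snd (D (Suc 0) t))) (?\<mu> t)"
      unfolding 1[OF t] 2[OF t] frame_mu_def
      by (simp_all add: pip_linear_simps frame_m_simps pip_m_m)
  qed
  \<comment> \<open>Smoothness differentiates \<open>D (Suc 0)\<close> once more and the frame
    equation differentiates \<mu>, so the product rule applies to their pairing.\<close>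
  obtain a where a: "(\<alpha> has_vector_derivative a) (at s within I)"
    using has_vector_derivative_transform[OF s \<alpha>
      has_vector_derivative_minus[OF has_vector_derivative_pip[OF fst_D[OF s] d\<mu>[OF s]]]]
    by blast
  obtain b where b: "(n has_vector_derivative b) (at s within I)"
    using has_vector_derivative_transform[OF s n
      has_vector_derivative_minus[OF has_vector_derivative_pip[OF snd_D[OF s] d\<mu>[OF s]]]]
    by blast
  show "(\<alpha> has_vector_derivative deriv_within I \<alpha> s) (at s within I)"
    "(n has_vector_derivative deriv_within I n s) (at s within I)"
    using a b deriv_within_eqI[OF I s a] deriv_within_eqI[OF I s b] by simp_all
qed

lemma height_ds_eq:
  fixes I :: "real set"
  assumes I: "is_interval I" "interior I \<noteq> {}"
    and curvature: "has_curvature I \<gamma> f1 f2 \<alpha> l n"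
    and s: "s \<in> I"
  shows "height_ds I \<gamma> f1 f2 s v = - \<alpha> s * pip (\<gamma> s) v + n s * pip (f2 s) v"
proof -
  have "(frame_mu \<gamma> f1 f2 has_vector_derivative - \<alpha> s *\<^sub>R \<gamma> s + n s *\<^sub>R f2 s) (at s within I)"
    using curvature s unfolding has_curvature_def Let_def by blast
  from deriv_within_eqI[OF I s has_vector_derivative_pip[OF this has_vector_derivative_const[of v]]]
  show ?thesis
    unfolding height_ds_def height_fun_def by (simp add: pip_linear_simps)
qed

text \<open>Product rule applied to the first-derivative formula, which holds throughout
  \<open>I\<close>; the terms in \<mu> come from differentiating \<gamma> and
  \<open>f2\<close>.\<close>

lemma height_dss_eq:
  fixes I :: "real set"
  assumes I: "is_interval I" "interior I \<noteq> {}"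
    and framed: "timelike_framed_immersion I \<gamma> f1 f2"
    and curvature: "has_curvature I \<gamma> f1 f2 \<alpha> l n"
    and s: "s \<in> I"
  shows "height_dss I \<gamma> f1 f2 s v =
    - deriv_within I \<alpha> s * pip (\<gamma> s) v - (\<alpha> s)\<^sup>2 * pip (frame_mu \<gamma> f1 f2 s) v
    + deriv_within I n s * pip (f2 s) v
    + n s * (- l s * pip (f1 s) v + n s * pip (frame_mu \<gamma> f1 f2 s) v)"
proof -
  let ?\<mu> = "frame_mu \<gamma> f1 f2"
  have d\<gamma>: "(\<gamma> has_vector_derivative \<alpha> s *\<^sub>R ?\<mu> s) (at s within I)"
    and df2: "(f2 has_vector_derivative - l s *\<^sub>R f1 s + n s *\<^sub>R ?\<mu> s) (at s within I)"
    using curvature s unfolding has_curvature_def Let_def by blast+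
  note d\<alpha> = curvature_differentiable(1)[OF assms] and dn = curvature_differentiable(2)[OF assms]
  note const = has_vector_derivative_const[of v]
  note mult = bounded_bilinear.has_vector_derivative[OF bounded_bilinear_mult]
  note d = has_vector_derivative_add[OF
      mult[OF has_vector_derivative_minus[OF d\<alpha>] has_vector_derivative_pip[OF d\<gamma> const]]
      mult[OF dn has_vector_derivative_pip[OF df2 const]]]
  note deriv_within_eqI[OF I s
      has_vector_derivative_transform[OF s height_ds_eq[OF I curvature] d]]
  then show ?thesis
    unfolding height_dss_def
    by (simp add: pip_linear_simps algebra_simps power2_eq_square)
qed

theorem proposition5p10:
  fixes I :: "real set"
    and \<gamma> f1 f2 :: "real \<Rightarrow> real^4"
    and \<alpha> l n :: "real \<Rightarrow> real"
    and s0 :: real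
  assumes interval: "is_interval I" "interior I \<noteq> {}"
    and framed: "timelike_framed_immersion I \<gamma> f1 f2"
    and curvature: "has_curvature I \<gamma> f1 f2 \<alpha> l n"
    and n_nz: "\<forall>s\<in>I. n s \<noteq> 0"
    and alpha_n: "\<forall>s\<in>I. (\<alpha> s)\<^sup>2 \<noteq> (n s)\<^sup>2"
    and discr_nz: "\<forall>s\<in>I. evolute_discr I \<alpha> l n s \<noteq> 0"
    and s0: "s0 \<in> I"
  shows
    "(evolute_discr I \<alpha> l n s0 < 0 \<and> (n s0)\<^sup>2 > (\<alpha> s0)\<^sup>2 \<longrightarrow>
       (\<forall>v0\<in>AdS3.
          (height_fun \<gamma> f1 f2 s0 v0 = 0 \<longleftrightarrow>
             (\<exists>a b c. v0 = a *\<^sub>R \<gamma> s0 + b *\<^sub>R f1 s0 + c *\<^sub>R f2 s0 \<and>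
                      - a\<^sup>2 + b\<^sup>2 + c\<^sup>2 = - 1)) \<and>
          (height_fun \<gamma> f1 f2 s0 v0 = 0 \<and> height_ds I \<gamma> f1 f2 s0 v0 = 0 \<longleftrightarrow>
             (\<exists>a b. v0 = a *\<^sub>R \<gamma> s0 + b *\<^sub>R f1 s0 - (a * \<alpha> s0 / n s0) *\<^sub>R f2 s0 \<and>
                    (n s0)\<^sup>2 * (1 + b\<^sup>2) = a\<^sup>2 * ((n s0)\<^sup>2 - (\<alpha> s0)\<^sup>2))) \<and>
          (height_fun \<gamma> f1 f2 s0 v0 = 0 \<and> height_ds I \<gamma> f1 f2 s0 v0 = 0 \<and>
           height_dss I \<gamma> f1 f2 s0 v0 = 0 \<longleftrightarrow>
             v0 \<in> total_evolute I \<gamma> f1 f2 \<alpha> l n s0)))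
     \<and>
     (evolute_discr I \<alpha> l n s0 > 0 \<longrightarrow>
       (\<forall>v0\<in>S32.
          (height_fun \<gamma> f1 f2 s0 v0 = 0 \<longleftrightarrow>
             (\<exists>a b c. v0 = a *\<^sub>R \<gamma> s0 + b *\<^sub>R f1 s0 + c *\<^sub>R f2 s0 \<and>
                      - a\<^sup>2 + b\<^sup>2 + c\<^sup>2 = 1)) \<and>
          (height_fun \<gamma> f1 f2 s0 v0 = 0 \<and> height_ds I \<gamma> f1 f2 s0 v0 = 0 \<longleftrightarrow>
             (\<exists>a b. v0 = a *\<^sub>R \<gamma> s0 + b *\<^sub>R f1 s0 - (a * \<alpha> s0 / n s0) *\<^sub>R f2 s0 \<and>
                    (n s0)\<^sup>2 * (b\<^sup>2 - 1) = a\<^sup>2 * ((n s0)\<^sup>2 - (\<alpha> s0)\<^sup>2) \<and>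
                    (b\<^sup>2 - 1 = 0 \<or> sgn (b\<^sup>2 - 1) = sgn ((n s0)\<^sup>2 - (\<alpha> s0)\<^sup>2)))) \<and>
          (height_fun \<gamma> f1 f2 s0 v0 = 0 \<and> height_ds I \<gamma> f1 f2 s0 v0 = 0 \<and>
           height_dss I \<gamma> f1 f2 s0 v0 = 0 \<longleftrightarrow>
             v0 \<in> total_evolute I \<gamma> f1 f2 \<alpha> l n s0)))"
proof -
  interpret timelike_frame "\<gamma> s0" "f1 s0" "f2 s0"
    using framed s0 by (rule framed_timelike_frame)
  note ds = height_ds_eq[OF interval curvature s0]
    and dss = height_dss_eq[OF interval framed curvature s0]
  have n: "n s0 \<noteq> 0"
    using n_nz s0 by blast
  have order_3: "height_fun \<gamma> f1 f2 s0 x = 0 \<and> height_ds I \<gamma> f1 f2 s0 x = 0 \<and>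
      height_dss I \<gamma> f1 f2 s0 x = 0 \<longleftrightarrow> x \<in> total_evolute I \<gamma> f1 f2 \<alpha> l n s0"
    if "pip x x = sgn (evolute_discr I \<alpha> l n s0)" for x
    unfolding ds dss height_fun_def frame_mu_def total_evolute_def Let_def evolute_discr_def
    using that n discr_nz s0 unfolding evolute_discr_def by (intro contact_order_3) auto
  \<comment> \<open>The sign clause of (ii)(b): \<open>q\<close> is \<open>r\<close> times a square,
    and \<open>a = 0\<close> accounts for the alternative \<open>q = 0\<close>.\<close>
  have same_sign: "q = 0 \<or> sgn q = sgn r" if "(n s0)\<^sup>2 * q = a\<^sup>2 * r" for q r a :: real
  proof -
    have "q = (a / n s0)\<^sup>2 * r"
      using that n by (simp add: power_divide field_simps)
    then show ?thesis
      using n by (auto simp: sgn_if zero_less_mult_iff)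
  qed
  show ?thesis
  proof (intro conjI impI ballI)
    fix x assume "x \<in> AdS3"
    then have x: "pip x x = - 1"
      by (simp add: AdS3_def)
    show "height_fun \<gamma> f1 f2 s0 x = 0 \<longleftrightarrow>
       (\<exists>a b c. x = a *\<^sub>R \<gamma> s0 + b *\<^sub>R f1 s0 + c *\<^sub>R f2 s0 \<and> - a\<^sup>2 + b\<^sup>2 + c\<^sup>2 = - 1)"
      unfolding height_fun_def frame_mu_def using x by (rule contact_order_1)
    show "height_fun \<gamma> f1 f2 s0 x = 0 \<and> height_ds I \<gamma> f1 f2 s0 x = 0 \<longleftrightarrow>
       (\<exists>a b. x = a *\<^sub>R \<gamma> s0 + b *\<^sub>R f1 s0 - (a * \<alpha> s0 / n s0) *\<^sub>R f2 s0 \<and>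
          (n s0)\<^sup>2 * (1 + b\<^sup>2) = a\<^sup>2 * ((n s0)\<^sup>2 - (\<alpha> s0)\<^sup>2))"
      unfolding ds height_fun_def frame_mu_def
      using contact_order_2[OF x n, of "\<alpha> s0"] by (simp add: add.commute)
    assume "evolute_discr I \<alpha> l n s0 < 0 \<and> (n s0)\<^sup>2 > (\<alpha> s0)\<^sup>2"
    then show "height_fun \<gamma> f1 f2 s0 x = 0 \<and> height_ds I \<gamma> f1 f2 s0 x = 0 \<and>
      height_dss I \<gamma> f1 f2 s0 x = 0 \<longleftrightarrow> x \<in> total_evolute I \<gamma> f1 f2 \<alpha> l n s0"
      using x by (intro order_3) simp
  next
    fix x assume "x \<in> S32"
    then have x: "pip x x = 1"
      by (simp add: S32_def)
    show "height_fun \<gamma> f1 f2 s0 x = 0 \<longleftrightarrow>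
       (\<exists>a b c. x = a *\<^sub>R \<gamma> s0 + b *\<^sub>R f1 s0 + c *\<^sub>R f2 s0 \<and> - a\<^sup>2 + b\<^sup>2 + c\<^sup>2 = 1)"
      unfolding height_fun_def frame_mu_def using x by (rule contact_order_1)
    show "height_fun \<gamma> f1 f2 s0 x = 0 \<and> height_ds I \<gamma> f1 f2 s0 x = 0 \<longleftrightarrow>
       (\<exists>a b. x = a *\<^sub>R \<gamma> s0 + b *\<^sub>R f1 s0 - (a * \<alpha> s0 / n s0) *\<^sub>R f2 s0 \<and>
          (n s0)\<^sup>2 * (b\<^sup>2 - 1) = a\<^sup>2 * ((n s0)\<^sup>2 - (\<alpha> s0)\<^sup>2) \<and>
          (b\<^sup>2 - 1 = 0 \<or> sgn (b\<^sup>2 - 1) = sgn ((n s0)\<^sup>2 - (\<alpha> s0)\<^sup>2)))"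
      unfolding ds height_fun_def frame_mu_def contact_order_2[OF x n]
      using same_sign by blast
    assume "evolute_discr I \<alpha> l n s0 > 0"
    then show "height_fun \<gamma> f1 f2 s0 x = 0 \<and> height_ds I \<gamma> f1 f2 s0 x = 0 \<and>
      height_dss I \<gamma> f1 f2 s0 x = 0 \<longleftrightarrow> x \<in> total_evolute I \<gamma> f1 f2 \<alpha> l n s0"
      using x by (intro order_3) simp
  qed
qed

end
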